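(* For a connected graph $G$, $\operatorname{th}_{\rm pd}^{\times}(G)\ge 1$; moreover, $\operatorname{th}_{\rm pd}^{\times}(G)=1$ if and only if $\gamma(G)=1$. Consequently $\operatorname{th}_{\rm pd}^{\times}(K_n)=1$ and $\operatorname{th}_{\rm pd}^{\times}(K_{1,n-1})=1$.
   Context: All graphs are finite, simple and undirected with at least one vertex. $K_n$ is the complete graph on $n$ vertices and $K_{1,n-1}$ is the star on $n$ vertices. Let $G$ be a graph. $\gamma(G)$ is the domination number: the minimum $|S|$ over $S\subseteq V(G)$ with $N[S]=V(G)$, where $N[S]$ is the closed neighborhood of $S$. For nonempty $S\subseteq V(G)$ define $P^{[0]}(S)=S$, $P^{[1]}(S)=N[S]$, and for $i\ge 1$, $P^{[i+1]}(S)=P^{[i]}(S)\cup\{w\in V(G)\setminus P^{[i]}(S): \exists u\in P^{[i]}(S),\ N(u)\setminus P^{[i]}(S)=\{w\}\}$. $S$ is a power dominating set if $P^{[t]}(S)=V(G)$ for some $t$. The power propagation time $\operatorname{pt}_{\rm pd}(G;S)$ is the least positive integer $t$ with $P^{[t]}(S)=V(G)$ (so it is at least $1$, even for $S=V(G)$), and is $\infty$ if $S$ is not a power dominating set. The product power throttling number is $\operatorname{th}_{\rm pd}^{\times}(G)=\min_{\emptyset\ne S\subseteq V(G)}|S|\operatorname{pt}_{\rm pd}(G;S)$. *)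

theory Defs
  imports "Graph_Theory.Kuratowski" "HOL-Library.Extended_Nat"
begin

text \<open>
  Finite simple undirected graphs are the symmetric loop-free digraphs without parallel arcs of the
  locale \<^locale>\<open>graph\<close>. That locale admits the graph without vertices, but
  \<^const>\<open>Digraph_Component.connected\<close> does not.
\<close>

definition open_nbhd :: "('a, 'b) pre_digraph \<Rightarrow> 'a \<Rightarrow> 'a set" where
  "open_nbhd G v = {w. v \<rightarrow>\<^bsub>G\<^esub> w}"

definition closed_nbhd :: "('a, 'b) pre_digraph \<Rightarrow> 'a set \<Rightarrow> 'a set" where
  "closed_nbhd G S = S \<union> (\<Union>v\<in>S. open_nbhd G v)"

definition domination_number :: "('a, 'b) pre_digraph \<Rightarrow> nat" where
  "domination_number G = (MIN S \<in> {S. S \<subseteq> verts G \<and> closed_nbhd G S = verts G}. card S)"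

fun pd_observed :: "('a, 'b) pre_digraph \<Rightarrow> 'a set \<Rightarrow> nat \<Rightarrow> 'a set" where
  "pd_observed G S 0 = S"
| "pd_observed G S (Suc 0) = closed_nbhd G S"
| "pd_observed G S (Suc (Suc i)) =
    pd_observed G S (Suc i) \<union>
    {w \<in> verts G - pd_observed G S (Suc i).
      \<exists>u \<in> pd_observed G S (Suc i). open_nbhd G u - pd_observed G S (Suc i) = {w}}"

definition power_dominating_set :: "('a, 'b) pre_digraph \<Rightarrow> 'a set \<Rightarrow> bool" where
  "power_dominating_set G S \<longleftrightarrow>
    S \<noteq> {} \<and> S \<subseteq> verts G \<and> (\<exists>t. pd_observed G S t = verts G)"

definition pd_propagation_time :: "('a, 'b) pre_digraph \<Rightarrow> 'a set \<Rightarrow> enat" where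
  "pd_propagation_time G S =
    (if power_dominating_set G S
     then enat (LEAST t. 0 < t \<and> pd_observed G S t = verts G) else \<infinity>)"

definition product_power_throttling :: "('a, 'b) pre_digraph \<Rightarrow> enat" where
  "product_power_throttling G =
    (MIN S \<in> {S. S \<noteq> {} \<and> S \<subseteq> verts G}. enat (card S) * pd_propagation_time G S)"

end

theory Submission
  imports Defs
begin

text \<open>Every nonempty vertex set has size at least 1 and propagation time at least 1, so each
  product \<open>|S| * pt(S)\<close> is at least 1, and it equals 1 exactly when both factors do.
  Time 1 means that the first stage, the closed neighborhood, is already everything, because forcing
  begins only at the second stage. Hence the value 1 is attained iff a single vertex dominates, and
  that is also what domination number 1 says. The two equivalences
  \<open>product_power_throttling_eq_1_iff\<close> and \<open>domination_number_eq_1_iff\<close>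
  share this right-hand side. In a complete graph any vertex dominates, in a star the center
  does.\<close>

context fin_digraph
begin

lemma pd_propagation_time_ge_1: "1 \<le> pd_propagation_time G S"
proof (cases "power_dominating_set G S")
  case True
  let ?Q = "\<lambda>t. 0 < t \<and> pd_observed G S t = verts G"
  from True obtain t where t: "pd_observed G S t = verts G" and S: "S \<subseteq> verts G"
    by (auto simp: power_dominating_set_def)
  have "\<exists>t. ?Q t"
  proof (cases t)
    \<comment> \<open>Being power dominating may be witnessed by stage 0, which the minimum over
      positive times excludes. Then \<open>S\<close> is the whole vertex set, and stage 1 is too, as
      arcs never leave \<open>verts G\<close>.\<close>
    case 0
    with t have "S = verts G" by simp
    then have "?Q 1"
      by (auto simp: closed_nbhd_def open_nbhd_def adj_in_verts)
    then show ?thesis ..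
  qed (use t in blast)
  then have "?Q (LEAST t. ?Q t)" by (rule LeastI_ex)
  with True show ?thesis
    by (simp add: pd_propagation_time_def one_enat_def)
qed (simp add: pd_propagation_time_def)

text \<open>This removes the forcing process: from here on only ordinary domination matters.\<close>

lemma pd_propagation_time_eq_1_iff:
  assumes "S \<noteq> {}" "S \<subseteq> verts G"
  shows "pd_propagation_time G S = 1 \<longleftrightarrow> closed_nbhd G S = verts G"
proof
  assume time: "pd_propagation_time G S = 1"
  let ?Q = "\<lambda>t. 0 < t \<and> pd_observed G S t = verts G"
  have pds: "power_dominating_set G S" and least: "(LEAST t. ?Q t) = 1"
    using time by (auto simp: pd_propagation_time_def one_enat_def split: if_splits)
  from pds obtain t where t: "pd_observed G S t = verts G"
    by (auto simp: power_dominating_set_def)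
  show "closed_nbhd G S = verts G"
  proof (cases t)
    case 0
    with t show ?thesis by (auto simp: closed_nbhd_def open_nbhd_def adj_in_verts)
  next
    \<comment> \<open>A positive witness makes \<open>LEAST\<close> meaningful: the least time,
      known to be 1, then satisfies \<open>?Q\<close> itself.\<close>
    case (Suc k)
    with t have "?Q t" by simp
    then have "?Q (LEAST t. ?Q t)" by (rule LeastI)
    then have "pd_observed G S 1 = verts G" unfolding least ..
    then show ?thesis by simp
  qed
next
  assume dom: "closed_nbhd G S = verts G"
  then have obs: "pd_observed G S 1 = verts G" by simp
  then have "power_dominating_set G S"
    using assms unfolding power_dominating_set_def by blast
  moreover have "(LEAST t. 0 < t \<and> pd_observed G S t = verts G) = 1"
    using obs by (intro Least_equality) auto
  ultimately show "pd_propagation_time G S = 1"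
    by (simp add: pd_propagation_time_def one_enat_def)
qed

lemma enat_card_ge_1:
  assumes "S \<noteq> {}" "S \<subseteq> verts G"
  shows "1 \<le> enat (card S)"
  using assms finite_subset[OF _ finite_verts] by (simp add: one_enat_def Suc_le_eq card_gt_0_iff)

lemma product_power_throttling_ge_1:
  assumes "verts G \<noteq> {}"
  shows "1 \<le> product_power_throttling G"
proof -
  \<comment> \<open>Writing the bound as \<open>1 * 1\<close> lets monotonicity of multiplication
    combine the bounds on the two factors.\<close>
  have "1 * 1 \<le> enat (card S) * pd_propagation_time G S" if "S \<noteq> {}" "S \<subseteq> verts G" for S
    using that by (intro mult_mono enat_card_ge_1 pd_propagation_time_ge_1) auto
  moreover have "finite {S. S \<noteq> {} \<and> S \<subseteq> verts G}" by simp
  ultimately show ?thesis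
    using assms unfolding product_power_throttling_def by (subst Min_ge_iff) auto
qed

text \<open>The minimum over a finite nonempty family is attained, so value 1 yields an actual
  \<open>S\<close> with product 1; conversely a dominating vertex gives a product that meets the
  lower bound.\<close>

lemma product_power_throttling_eq_1_iff:
  assumes "verts G \<noteq> {}"
  shows "product_power_throttling G = 1 \<longleftrightarrow> (\<exists>v\<in>verts G. closed_nbhd G {v} = verts G)"
proof
  let ?A = "{S. S \<noteq> {} \<and> S \<subseteq> verts G}"
  let ?f = "\<lambda>S. enat (card S) * pd_propagation_time G S"
  have fin: "finite (?f ` ?A)" by simp
  {
    assume "product_power_throttling G = 1"
    moreover have "Min (?f ` ?A) \<in> ?f ` ?A"
      using assms fin by (intro Min_in) auto
    ultimately have "1 \<in> ?f ` ?A"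
      unfolding product_power_throttling_def by (simp only:)
    then obtain S where one: "1 = ?f S" and "S \<in> ?A" by (rule imageE)
    then have S: "S \<noteq> {}" "S \<subseteq> verts G" by auto
    \<comment> \<open>An infinite time is impossible, since its product with any cardinality is 0 or
      infinite; a finite product of naturals is 1 only if both factors are.\<close>
    have "card S = 1 \<and> pd_propagation_time G S = 1"
      using one by (cases "pd_propagation_time G S") (auto simp: one_enat_def zero_enat_def split: if_splits)
    then show "\<exists>v\<in>verts G. closed_nbhd G {v} = verts G"
      using S pd_propagation_time_eq_1_iff[OF S] by (auto simp: card_1_singleton_iff)
  next
    assume "\<exists>v\<in>verts G. closed_nbhd G {v} = verts G"
    then obtain v where v: "{v} \<in> ?A" and "closed_nbhd G {v} = verts G" by blast
    then have "pd_propagation_time G {v} = 1" by (simp add: pd_propagation_time_eq_1_iff)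
    then have "?f {v} = 1" by (simp add: one_enat_def)
    then have "product_power_throttling G \<le> 1"
      unfolding product_power_throttling_def using fin v
      by (intro Min_le) (auto intro: rev_image_eqI)
    then show "product_power_throttling G = 1"
      using product_power_throttling_ge_1[OF assms] by (rule antisym)
  }
qed

lemma domination_number_eq_1_iff:
  assumes "verts G \<noteq> {}"
  shows "domination_number G = 1 \<longleftrightarrow> (\<exists>v\<in>verts G. closed_nbhd G {v} = verts G)"
proof
  let ?D = "{S. S \<subseteq> verts G \<and> closed_nbhd G S = verts G}"
  have fin: "finite (card ` ?D)" by simp
  have "verts G \<in> ?D"
    by (auto simp: closed_nbhd_def open_nbhd_def adj_in_verts)
  then have ne: "card ` ?D \<noteq> {}" by blast
  have pos: "1 \<le> card S" if "S \<in> ?D" for S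
  proof -
    \<comment> \<open>The empty set has empty closed neighborhood, so it cannot dominate a nonempty
      graph.\<close>
    have "S \<noteq> {}" using that assms by (auto simp: closed_nbhd_def)
    then show ?thesis
      using that finite_subset[OF _ finite_verts] by (auto simp: Suc_le_eq card_gt_0_iff)
  qed
  {
    assume "domination_number G = 1"
    with Min_in[OF fin ne] obtain S where "S \<in> ?D" "card S = 1"
      unfolding domination_number_def by auto
    then show "\<exists>v\<in>verts G. closed_nbhd G {v} = verts G"
      by (auto simp: card_1_singleton_iff)
  next
    assume "\<exists>v\<in>verts G. closed_nbhd G {v} = verts G"
    then obtain v where "{v} \<in> ?D" by blast
    then have "1 \<in> card ` ?D" by (force simp: image_iff)
    with pos show "domination_number G = 1"
      unfolding domination_number_def by (intro Min_eqI fin) auto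
  }
qed

end

lemma product_power_throttling_complete_digraph:
  assumes "n \<ge> 1" "complete_digraph n K"
  shows "product_power_throttling K = 1"
proof -
  interpret graph K using assms by (simp add: complete_digraph_def)
  obtain v where v: "v \<in> verts K"
    using assms by (fastforce simp: complete_digraph_def)
  then have "closed_nbhd K {v} = verts K"
    using assms by (auto simp: complete_digraph_def closed_nbhd_def open_nbhd_def)
  with v show ?thesis
    using product_power_throttling_eq_1_iff by blast
qed

lemma product_power_throttling_star:
  assumes "complete_bipartite_digraph 1 m H"
  shows "product_power_throttling H = 1"
proof -
  interpret graph H using assms by (simp add: complete_bipartite_digraph_def)
  \<comment> \<open>The part of size 1 is the center \<open>v\<close>, joined to every vertex of
    \<open>V\<close>; \<open>m = 0\<close> gives the one-vertex star.\<close>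
  obtain v V where "verts H = {v} \<union> V" "arcs_ends H = {v} \<times> V \<union> V \<times> {v}"
    using assms by (auto simp: complete_bipartite_digraph_def card_1_singleton_iff)
  then have "v \<in> verts H" "closed_nbhd H {v} = verts H"
    by (auto simp: closed_nbhd_def open_nbhd_def)
  then show ?thesis
    using product_power_throttling_eq_1_iff by blast
qed

theorem mainTheorem8:
  shows "(\<forall>G :: ('a, 'b) pre_digraph. graph G \<and> Digraph_Component.connected G \<longrightarrow>
            product_power_throttling G \<ge> 1 \<and>
            (product_power_throttling G = 1 \<longleftrightarrow> domination_number G = 1)) \<and>
         (\<forall>n \<ge> 1. \<forall>K :: ('a, 'b) pre_digraph. complete_digraph n K \<longrightarrow>
            product_power_throttling K = 1) \<and>
         (\<forall>n \<ge> 1. \<forall>H :: ('a, 'b) pre_digraph. complete_bipartite_digraph 1 (n - 1) H \<longrightarrow>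
            product_power_throttling H = 1)"
proof (intro conjI allI impI)
  fix G :: "('a, 'b) pre_digraph"
  assume G: "graph G \<and> Digraph_Component.connected G"
  then interpret graph G by simp
  \<comment> \<open>Connectedness rules out the empty graph, so the throttling minimum ranges over a
    nonempty family.\<close>
  have ne: "verts G \<noteq> {}"
    using G by (simp add: Digraph_Component.connected_def strongly_connected_def)
  show "product_power_throttling G \<ge> 1"
    using ne by (rule product_power_throttling_ge_1)
  show "product_power_throttling G = 1 \<longleftrightarrow> domination_number G = 1"
    unfolding product_power_throttling_eq_1_iff[OF ne] domination_number_eq_1_iff[OF ne] by (rule refl)
qed (rule product_power_throttling_complete_digraph product_power_throttling_star; assumption)+

end
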